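(* Let $p$ be a prime. For any $g=\begin{pmatrix} a & b \\ c & d \end{pmatrix}\in\overline{\mathrm{GL}}(2\infty,\mathbb{O}_p)$ and any $z\in\mathrm{Mat}(\infty,\mathbb{Q}_p)$, the expression $\det(a+zc)\in\mathbb{Q}_p$ is well defined; that is, for all sufficiently large $k$ the value $\det\bigl(a_{11}^{(k)}+z_{11}^{(k)}c_{11}^{(k)}\bigr)\in\mathbb{Q}_p$, which is taken as the meaning of $\det(a+zc)$, does not depend on $k$.
   Context: $\mathbb{Q}_p$ is the field of $p$-adic numbers, $\mathbb{O}_p$ the ring of $p$-adic integers, $\mathrm{Mat}(\infty,\mathbb{Q}_p)$ the space of all infinite matrices $(z_{ij})_{i,j\ge1}$ over $\mathbb{Q}_p$. $\mathrm{GL}(2\infty,\mathbb{O}_p)$ is the group of $(\infty+\infty)\times(\infty+\infty)$ block matrices $g$ with entries in $\mathbb{O}_p$ such that $g^{-1}$ has entries in $\mathbb{O}_p$ and $g-1$ has only finitely many nonzero entries. $\overline{T}$ is the group of $(\infty+\infty)\times(\infty+\infty)$ matrices $\begin{pmatrix} a & b \\ 0 & d \end{pmatrix}$ over $\mathbb{O}_p$ where $a$ is lower triangular, $d$ is upper triangular, all diagonal entries of $a$ and $d$ are equal to $1$, and $b$ is arbitrary. $\overline{\mathrm{GL}}(2\infty,\mathbb{O}_p)$ is the group of matrices generated by $\mathrm{GL}(2\infty,\mathbb{O}_p)$ and $\overline{T}$; it consists of the invertible matrices $g=\begin{pmatrix} a & b \\ c & d \end{pmatrix}$ over $\mathbb{O}_p$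 such that $c$ has only finitely many nonzero entries, $a-1$ has only finitely many nonzero entries on and above the diagonal, $d-1$ has only finitely many nonzero entries on and below the diagonal, and $g^{-1}$ has entries in $\mathbb{O}_p$. For a matrix $x\in\{a,c,z\}$, $x_{11}^{(k)}$ denotes its upper left $k\times k$ corner. For $k$ sufficiently large, in blocks of size $k+\infty$, $a=\begin{pmatrix} a_{11}^{(k)} & 0 \\ a_{21}^{(k)} & a_{22}^{(k)} \end{pmatrix}$ with $a_{22}^{(k)}$ lower triangular with unit diagonal, and $c=\begin{pmatrix} c_{11}^{(k)} & 0 \\ 0 & 0 \end{pmatrix}$, so that $a+zc=\begin{pmatrix} a_{11}^{(k)}+z_{11}^{(k)}c_{11}^{(k)} & 0 \\ a_{21}^{(k)}+z_{21}^{(k)}c_{11}^{(k)} & a_{22}^{(k)} \end{pmatrix}$, where $z_{21}^{(k)}$ is the lower left block of $z$. *)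

theory Defs
  imports
    "HOL-Library.Groups_Big_Fun"
    "HOL-Computational_Algebra.Normalized_Fraction"
    "Berlekamp_Zassenhaus.Finite_Field"
    "Jordan_Normal_Form.Determinant"
begin

text \<open>
  The prime is carried by a type variable of class \<^class>\<open>prime_card\<close>: the number p is
  \<open>CARD('p)\<close>, which that class requires to be prime.  The ring of p-adic integers is the
  inverse limit of the rings of integers modulo \<open>p ^ n\<close>.  The single condition below also
  forces \<open>x n\<close> to be the reduced residue, i.e. \<open>0 \<le> x n < p ^ n\<close>.
\<close>

typedef (overloaded) 'p padic_int =
  "{x :: nat \<Rightarrow> int. \<forall>n. x (Suc n) mod int CARD('p::prime_card) ^ n = x n}"
  by (rule exI[of _ "\<lambda>_. 0"]) simp

setup_lifting type_definition_padic_int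

lemma mod_power_Suc_cancel: "(x :: int) mod p ^ Suc n mod p ^ n = x mod p ^ n"
  by (rule mod_mod_cancel) simp

lemma coherent_reduced:
  fixes x :: "nat \<Rightarrow> int"
  assumes "\<forall>n. x (Suc n) mod p ^ n = x n"
  shows "x n mod p ^ n = x n"
  using assms by (metis mod_mod_trivial)

lemma coherent_mod:
  fixes x :: "nat \<Rightarrow> int"
  assumes "\<forall>n. x (Suc n) mod p ^ n = x n" and "m \<le> n"
  shows "x n mod p ^ m = x m"
  using assms(2)
proof (induction n rule: dec_induct)
  case base
  show ?case by (rule coherent_reduced[OF assms(1)])
next
  case (step n)
  have "x (Suc n) mod p ^ m = x (Suc n) mod p ^ n mod p ^ m"
    using step.hyps by (intro mod_mod_cancel[symmetric] le_imp_power_dvd) simp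
  then show ?case using assms(1) step.IH by simp
qed

instantiation padic_int :: (prime_card) comm_ring_1
begin

lift_definition zero_padic_int :: "'a padic_int" is "\<lambda>_. 0" by simp

lift_definition one_padic_int :: "'a padic_int" is "\<lambda>n. 1 mod int CARD('a) ^ n"
  by (simp only: mod_power_Suc_cancel simp_thms)

lift_definition plus_padic_int :: "'a padic_int \<Rightarrow> 'a padic_int \<Rightarrow> 'a padic_int"
  is "\<lambda>x y n. (x n + y n) mod int CARD('a) ^ n"
  by (simp only: mod_power_Suc_cancel) (metis mod_add_eq)

lift_definition times_padic_int :: "'a padic_int \<Rightarrow> 'a padic_int \<Rightarrow> 'a padic_int"
  is "\<lambda>x y n. (x n * y n) mod int CARD('a) ^ n"
  by (simp only: mod_power_Suc_cancel) (metis mod_mult_eq)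

lift_definition uminus_padic_int :: "'a padic_int \<Rightarrow> 'a padic_int"
  is "\<lambda>x n. (- x n) mod int CARD('a) ^ n"
  by (simp only: mod_power_Suc_cancel) (metis mod_minus_eq)

lift_definition minus_padic_int :: "'a padic_int \<Rightarrow> 'a padic_int \<Rightarrow> 'a padic_int"
  is "\<lambda>x y n. (x n - y n) mod int CARD('a) ^ n"
  by (simp only: mod_power_Suc_cancel) (metis mod_diff_eq)

instance
proof
  fix a b c :: "'a padic_int"
  show "a * b * c = a * (b * c)"
    by transfer (simp add: mod_simps mult.assoc)
  show "a * b = b * a"
    by transfer (simp add: mult.commute)
  show "1 * a = a"
    by transfer (simp add: mod_simps coherent_reduced)
  show "a + b + c = a + (b + c)"
    by transfer (simp add: mod_simps add.assoc)
  show "a + b = b + a"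
    by transfer (simp add: add.commute)
  show "0 + a = a"
    by transfer (simp add: coherent_reduced)
  show "- a + a = 0"
    by transfer (simp add: mod_simps)
  show "a - b = a + - b"
    by transfer (simp add: mod_simps)
  show "(a + b) * c = a * c + b * c"
    by transfer (simp add: mod_simps distrib_right)
  show "(0 :: 'a padic_int) \<noteq> 1"
  proof transfer
    have "1 mod int CARD('a) = 1"
      using prime_gt_1_int[OF prime_card_int[where 'a = 'a]] by simp
    then show "(\<lambda>_. 0) \<noteq> (\<lambda>n. 1 mod int CARD('a) ^ n)"
      by (metis power_one_right zero_neq_one)
  qed
qed

end

instance padic_int :: (prime_card) idom
proof
  fix a b :: "'a padic_int"
  assume "a \<noteq> 0" "b \<noteq> 0"
  then show "a * b \<noteq> 0"
  proof transfer
    let ?p = "int CARD('a)"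
    fix x y :: "nat \<Rightarrow> int"
    assume x: "\<forall>n. x (Suc n) mod ?p ^ n = x n" and y: "\<forall>n. y (Suc n) mod ?p ^ n = y n"
      and "x \<noteq> (\<lambda>_. 0)" "y \<noteq> (\<lambda>_. 0)"
    then obtain m n where mn: "x m \<noteq> 0" "y n \<noteq> 0" by blast
    have p: "prime_elem ?p" using prime_card_int[where 'a = 'a] by simp
    have "\<not> ?p ^ m dvd x (m + n)" "\<not> ?p ^ n dvd y (m + n)"
      using mn coherent_mod[OF x, of m "m + n"] coherent_mod[OF y, of n "m + n"]
      by (auto simp: dvd_eq_mod_eq_0)
    moreover from this have nz: "x (m + n) \<noteq> 0" "y (m + n) \<noteq> 0" by auto
    moreover have "\<not> is_unit ?p" using p prime_elem_not_unit by blast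
    ultimately have "multiplicity ?p (x (m + n)) < m" "multiplicity ?p (y (m + n)) < n"
      by (simp_all add: multiplicity_lessI)
    then have "multiplicity ?p (x (m + n) * y (m + n)) < m + n"
      using prime_elem_multiplicity_mult_distrib[OF p nz] by simp
    then have "\<not> ?p ^ (m + n) dvd x (m + n) * y (m + n)"
      using nz \<open>\<not> is_unit ?p\<close> by (simp add: power_dvd_iff_le_multiplicity)
    then show "(\<lambda>n. x n * y n mod ?p ^ n) \<noteq> (\<lambda>_. 0)"
      by (metis dvd_eq_mod_eq_0)
  qed
qed

type_synonym 'p padic = "'p padic_int fract"

definition padic_integers :: "'p::prime_card padic set" where
  "padic_integers = range to_fract"

text \<open>Natural number indices start at 0.  The index type \<open>nat + nat\<close> serves for
  matrices of size \<open>\<infinity> + \<infinity>\<close>, \<^const>\<open>Inl\<close> being the first block.\<close>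

type_synonym ('i, 'a) inf_mat = "'i \<Rightarrow> 'i \<Rightarrow> 'a"

definition inf_one :: "('i, 'a::zero_neq_one) inf_mat" where
  "inf_one i j = (if i = j then 1 else 0)"

text \<open>\<^const>\<open>Sum_any\<close> is the sum of a family with finitely many nonzero members, and 0 when
  there are infinitely many.  In the products of matrices from \<open>GL_bar\<close> below, all the sums
  have finitely many nonzero terms.\<close>

definition inf_mult :: "('i, 'a::comm_semiring_1) inf_mat \<Rightarrow> ('i, 'a) inf_mat \<Rightarrow> ('i, 'a) inf_mat"
  where "inf_mult g h i j = (\<Sum>k. g i k * h k j)"

fun block :: "(nat, 'a) inf_mat \<Rightarrow> (nat, 'a) inf_mat \<Rightarrow> (nat, 'a) inf_mat \<Rightarrow> (nat, 'a) inf_mat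
    \<Rightarrow> (nat + nat, 'a) inf_mat" where
  "block a b c d (Inl i) (Inl j) = a i j"
| "block a b c d (Inl i) (Inr j) = b i j"
| "block a b c d (Inr i) (Inl j) = c i j"
| "block a b c d (Inr i) (Inr j) = d i j"

definition corner :: "nat \<Rightarrow> (nat, 'a) inf_mat \<Rightarrow> 'a mat" where
  "corner k x = mat k k (\<lambda>(i, j). x i j)"

definition GL_2inf :: "(nat + nat, 'p::prime_card padic) inf_mat set" where
  "GL_2inf = {g. (\<forall>i j. g i j \<in> padic_integers) \<and>
     finite {(i, j). g i j \<noteq> inf_one i j} \<and>
     (\<exists>h. (\<forall>i j. h i j \<in> padic_integers) \<and> inf_mult g h = inf_one \<and> inf_mult h g = inf_one)}"

definition T_bar :: "(nat + nat, 'p::prime_card padic) inf_mat set" where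
  "T_bar = {block a b (\<lambda>_ _. 0) d | a b d.
     (\<forall>i j. a i j \<in> padic_integers \<and> b i j \<in> padic_integers \<and> d i j \<in> padic_integers) \<and>
     (\<forall>i j. i < j \<longrightarrow> a i j = 0) \<and> (\<forall>i j. j < i \<longrightarrow> d i j = 0) \<and>
     (\<forall>i. a i i = 1 \<and> d i i = 1)}"

text \<open>The group generated by \<^const>\<open>GL_2inf\<close> and \<^const>\<open>T_bar\<close>.  Both are groups, so their
  union contains the identity and the inverses of its elements, and the group generated by it
  is the set of all finite products of its elements.\<close>

inductive_set GL_bar :: "(nat + nat, 'p::prime_card padic) inf_mat set" where
  GL: "g \<in> GL_2inf \<Longrightarrow> g \<in> GL_bar"
| T: "g \<in> T_bar \<Longrightarrow> g \<in> GL_bar"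
| mult: "g \<in> GL_bar \<Longrightarrow> h \<in> GL_bar \<Longrightarrow> inf_mult g h \<in> GL_bar"

end

theory Submission
  imports Defs
begin

text \<open>
  Write the index set \<open>\<infinity> + \<infinity>\<close> as a two-sided sequence, with the first block running to the left
  and the second one to the right.  The elements of \<^const>\<open>T_bar\<close> then become upper unitriangular
  matrices, and those of \<^const>\<open>GL_2inf\<close> are matrices that differ from the identity only in a finite
  window around the centre.  Both are upper unitriangular outside a finite window, and this
  property passes to products (\<open>unitriangular_outside_mult\<close>): on or below the
  diagonal and outside the window, at most one term of the sum that defines the product is nonzero.
  So every element of \<^const>\<open>GL_bar\<close> has it.

  For the blocks \<open>a\<close> and \<open>c\<close> this says that \<open>c\<close> vanishes outside its upper left \<open>N \<times> N\<close> corner, and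
  that the columns of \<open>a\<close> from the \<open>N\<close>-th on agree with those of the identity on and above the
  diagonal.  Adding \<open>z c\<close> changes only the first \<open>N\<close> columns, so \<open>a + z c\<close> has the second property
  as well.  Passing from the corner of size \<open>k \<ge> N\<close> to the next one therefore adds a last column
  \<open>(0, \<dots>, 0, 1)\<close>, which leaves the determinant unchanged (\<open>det_corner_stable\<close>).
\<close>

section \<open>Matrices that are unitriangular outside a finite window\<close>

fun position :: "nat + nat \<Rightarrow> int" where
  "position (Inl i) = - int i - 1"
| "position (Inr i) = int i"

text \<open>The window consists of the first \<open>N\<close> indices of either block.\<close>

definition window :: "nat \<Rightarrow> (nat + nat) set" where
  "window N = {i. - int N \<le> position i \<and> position i < int N}"

lemma window_simps [simp]:
  "Inl i \<in> window N \<longleftrightarrow> i < N"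
  "Inr i \<in> window N \<longleftrightarrow> i < N"
  by (auto simp: window_def)

lemma window_mono: "M \<le> N \<Longrightarrow> window M \<subseteq> window N"
  by (auto simp: window_def)

lemma window_convex:
  assumes "i \<in> window N" "j \<in> window N" "position i \<le> position k" "position k \<le> position j"
  shows "k \<in> window N"
  using assms by (auto simp: window_def)

lemma finite_subset_window:
  assumes "finite A"
  shows "\<exists>N. A \<subseteq> window N"
proof -
  have "finite ((\<lambda>i. nat \<bar>position i\<bar>) ` A)" using assms by simp
  then obtain N where "\<forall>i\<in>A. nat \<bar>position i\<bar> < N"
    unfolding finite_nat_set_iff_bounded by blast
  then have "A \<subseteq> window N" by (force simp: window_def)
  then show ?thesis ..
qed

definition unitriangular_outside :: "nat \<Rightarrow> (nat + nat, 'a::zero_neq_one) inf_mat \<Rightarrow> bool" where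
  "unitriangular_outside N g \<longleftrightarrow>
    (\<forall>i j. position j \<le> position i \<longrightarrow> \<not> (i \<in> window N \<and> j \<in> window N) \<longrightarrow> g i j = inf_one i j)"

lemma unitriangular_outsideD:
  assumes "unitriangular_outside N g" "position j \<le> position i" "i \<notin> window N \<or> j \<notin> window N"
  shows "g i j = inf_one i j"
  using assms by (auto simp: unitriangular_outside_def)

lemma unitriangular_outside_mono:
  assumes "unitriangular_outside M g" "M \<le> N"
  shows "unitriangular_outside N g"
  using assms window_mono[OF assms(2)] unfolding unitriangular_outside_def by blast

text \<open>A family with at most one nonzero member has finite support, so that \<^const>\<open>Sum_any\<close> is its
  true sum and not the default value.\<close>

lemma Sum_any_eq_single:
  assumes "\<And>k. k \<noteq> l \<Longrightarrow> f k = 0"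
  shows "Sum_any f = f l"
proof -
  have "Sum_any f = sum f {l}"
    using assms by (intro Sum_any.expand_superset) auto
  then show ?thesis by simp
qed

text \<open>Let \<open>(i, j)\<close> be a place on or below the diagonal, with \<open>i\<close>, say, outside the window.  Row \<open>i\<close> of
  \<open>g\<close> is zero to the left of the diagonal.  An index \<open>k\<close> to the right of \<open>i\<close> gives a place \<open>(k, j)\<close>
  below the diagonal; as \<open>i\<close> lies between \<open>j\<close> and \<open>k\<close> and the window is convex, this
  place is outside the window and \<open>h k j = 0\<close>.  Only \<open>k = i\<close> is left.  If instead \<open>j\<close> is outside,
  only \<open>k = j\<close> is left, by the mirror image of the argument.\<close>

lemma unitriangular_outside_mult:
  assumes g: "unitriangular_outside N g" and h: "unitriangular_outside N h"
  shows "unitriangular_outside N (inf_mult g h)"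
  unfolding unitriangular_outside_def
proof (intro allI impI)
  fix i j
  assume le: "position j \<le> position i" and "\<not> (i \<in> window N \<and> j \<in> window N)"
  then consider "i \<notin> window N" | "j \<notin> window N" by blast
  then show "inf_mult g h i j = inf_one i j"
  proof cases
    case 1
    have "g i k * h k j = 0" if "k \<noteq> i" for k
    proof (cases "position k \<le> position i")
      case True
      then have "g i k = 0"
        using unitriangular_outsideD[OF g] 1 that by (simp add: inf_one_def)
      then show ?thesis by simp
    next
      case False
      then have "k \<notin> window N \<or> j \<notin> window N"
        using 1 le window_convex[of j N k i] by auto
      then have "h k j = 0"
        using unitriangular_outsideD[OF h, of j k] False le by (auto simp: inf_one_def)
      then show ?thesis by simp
    qed
    then have "inf_mult g h i j = g i i * h i j"
      unfolding inf_mult_def by (rule Sum_any_eq_single)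
    then show ?thesis
      using 1 le unitriangular_outsideD[OF g, of i i] unitriangular_outsideD[OF h, of j i]
      by (simp add: inf_one_def)
  next
    case 2
    have "g i k * h k j = 0" if "k \<noteq> j" for k
    proof (cases "position j \<le> position k")
      case True
      then have "h k j = 0"
        using unitriangular_outsideD[OF h] 2 that by (simp add: inf_one_def)
      then show ?thesis by simp
    next
      case False
      then have "i \<notin> window N \<or> k \<notin> window N"
        using 2 le window_convex[of k N i j] by auto
      then have "g i k = 0"
        using unitriangular_outsideD[OF g, of k i] False le by (auto simp: inf_one_def)
      then show ?thesis by simp
    qed
    then have "inf_mult g h i j = g i j * h j j"
      unfolding inf_mult_def by (rule Sum_any_eq_single)
    then show ?thesis
      using 2 le unitriangular_outsideD[OF h, of j j] unitriangular_outsideD[OF g, of j i]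
      by (simp add: inf_one_def)
  qed
qed

lemma unitriangular_outside_GL_2inf:
  assumes "g \<in> GL_2inf"
  shows "\<exists>N. unitriangular_outside N g"
proof -
  define D where "D = {(i, j). g i j \<noteq> inf_one i j}"
  have "finite (fst ` D \<union> snd ` D)"
    using assms by (auto simp: GL_2inf_def D_def)
  then obtain N where "fst ` D \<union> snd ` D \<subseteq> window N"
    using finite_subset_window by blast
  then have "unitriangular_outside N g"
    by (force simp: unitriangular_outside_def D_def)
  then show ?thesis ..
qed

lemma unitriangular_outside_T_bar:
  assumes "g \<in> T_bar"
  shows "unitriangular_outside 0 g"
proof -
  obtain a b d where g: "g = block a b (\<lambda>_ _. 0) d"
    and "\<forall>i j. i < j \<longrightarrow> a i j = 0" "\<forall>i j. j < i \<longrightarrow> d i j = 0" "\<forall>i. a i i = 1 \<and> d i i = 1"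
    using assms by (auto simp: T_bar_def)
  then have "g i j = inf_one i j" if "position j \<le> position i" for i j
    using that by (cases i; cases j) (auto simp: inf_one_def)
  then show ?thesis by (simp add: unitriangular_outside_def)
qed

lemma unitriangular_outside_GL_bar:
  assumes "g \<in> GL_bar"
  shows "\<exists>N. unitriangular_outside N g"
  using assms
proof induction
  case (GL g)
  then show ?case by (rule unitriangular_outside_GL_2inf)
next
  case (T g)
  then show ?case using unitriangular_outside_T_bar by blast
next
  case (mult g h)
  then obtain M N where "unitriangular_outside M g" "unitriangular_outside N h" by blast
  then have "unitriangular_outside (max M N) g" "unitriangular_outside (max M N) h"
    by (auto elim: unitriangular_outside_mono)
  then show ?case using unitriangular_outside_mult by blast
qed

section \<open>Determinants of corners\<close>

lemma corner_carrier [simp]: "corner k x \<in> carrier_mat k k"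
  by (simp add: corner_def)

lemma mat_delete_corner_Suc: "mat_delete (corner (Suc k) w) k k = corner k w"
  by (rule eq_matI) (auto simp: mat_delete_def corner_def)

text \<open>Expand along the last column.\<close>

lemma det_corner_Suc:
  fixes w :: "(nat, 'a::comm_ring_1) inf_mat"
  assumes "\<And>i. i \<le> k \<Longrightarrow> w i k = inf_one i k"
  shows "det (corner (Suc k) w) = det (corner k w)"
proof -
  let ?A = "corner (Suc k) w"
  have "det ?A = (\<Sum>i<Suc k. ?A $$ (i, k) * cofactor ?A i k)"
    by (rule laplace_expansion_column) auto
  also have "\<dots> = (\<Sum>i<Suc k. if i = k then cofactor ?A i k else 0)"
    by (rule sum.cong) (auto simp: corner_def assms inf_one_def)
  also have "\<dots> = cofactor ?A k k"
    by simp
  also have "\<dots> = det (corner k w)"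
    by (simp add: cofactor_def mat_delete_corner_Suc)
  finally show ?thesis .
qed

lemma det_corner_stable:
  fixes w :: "(nat, 'a::comm_ring_1) inf_mat"
  assumes "\<And>i j. i \<le> j \<Longrightarrow> N \<le> j \<Longrightarrow> w i j = inf_one i j" and "N \<le> k"
  shows "det (corner k w) = det (corner N w)"
  using assms(2)
proof (induction k rule: dec_induct)
  case (step k)
  then show ?case using assms(1) det_corner_Suc[of k w] by simp
qed simp

text \<open>The right-hand side is a corner of the infinite matrix \<open>a + z c\<close>: as the rows of \<open>c\<close> from the
  \<open>N\<close>-th on vanish, cutting \<open>z\<close> and \<open>c\<close> down to size \<open>k \<ge> N\<close> loses nothing of their product.\<close>

lemma corner_add_mult:
  fixes a c z :: "(nat, 'a::comm_ring_1) inf_mat"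
  assumes c: "\<And>l j. N \<le> l \<Longrightarrow> c l j = 0" and "N \<le> k"
  shows "corner k a + corner k z * corner k c = corner k (\<lambda>i j. a i j + (\<Sum>l<N. z i l * c l j))"
proof (rule eq_matI)
  fix i j
  assume "i < dim_row (corner k (\<lambda>i j. a i j + (\<Sum>l<N. z i l * c l j)))"
    and "j < dim_col (corner k (\<lambda>i j. a i j + (\<Sum>l<N. z i l * c l j)))"
  then have ij: "i < k" "j < k" by (simp_all add: corner_def)
  have "(\<Sum>l<N. z i l * c l j) = (\<Sum>l\<in>{0..<k}. z i l * c l j)"
    using assms by (intro sum.mono_neutral_left) auto
  then show "(corner k a + corner k z * corner k c) $$ (i, j)
      = corner k (\<lambda>i j. a i j + (\<Sum>l<N. z i l * c l j)) $$ (i, j)"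
    using ij by (simp add: corner_def scalar_prod_def)
qed (simp_all add: corner_def)

theorem proposition1p6:
  fixes a b c d z :: "nat \<Rightarrow> nat \<Rightarrow> 'p::prime_card padic"
  assumes "block a b c d \<in> GL_bar"
  shows "\<exists>!v. \<forall>\<^sub>F k in sequentially. det (corner k a + corner k z * corner k c) = v"
proof -
  let ?D = "\<lambda>k. det (corner k a + corner k z * corner k c)"
  obtain N where N: "unitriangular_outside N (block a b c d)"
    using unitriangular_outside_GL_bar[OF assms] ..
  have a: "a i j = inf_one i j" if "i \<le> j" "N \<le> j" for i j
    using unitriangular_outsideD[OF N, of "Inl j" "Inl i"] that by (simp add: inf_one_def)
  have c: "c i j = 0" if "N \<le> i \<or> N \<le> j" for i j
    using unitriangular_outsideD[OF N, of "Inl j" "Inr i"] that by (auto simp: inf_one_def)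
  define w where "w = (\<lambda>i j. a i j + (\<Sum>l<N. z i l * c l j))"
  have w: "w i j = inf_one i j" if "i \<le> j" "N \<le> j" for i j
    using that by (simp add: w_def a c)
  have "?D k = det (corner N w)" if "N \<le> k" for k
    using corner_add_mult[of N c k a z] det_corner_stable[of N w k] w c that
    by (simp add: w_def)
  then have ev: "\<forall>\<^sub>F k in sequentially. ?D k = det (corner N w)"
    unfolding eventually_sequentially by blast
  show ?thesis
  proof (rule ex1I)
    show "\<forall>\<^sub>F k in sequentially. ?D k = det (corner N w)" by (rule ev)
  next
    fix v assume "\<forall>\<^sub>F k in sequentially. ?D k = v"
    with ev have "\<forall>\<^sub>F k in sequentially. v = det (corner N w)"
      by eventually_elim simp
    then show "v = det (corner N w)" by simp
  qed
qed

end
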